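(* Let $0\le k<1$ and $0\le p<1$. Suppose that $\omega$ is an analytic function in $\mathbb D$ such that $|\omega'(z)|\le k(1+p)^{-2}$ for all $z\in\mathbb D$. Then the function $f$ given by $$f(z)=\frac{1}{z-p}+\omega(z),\qquad |z|<1,$$ is a member of $\Sigma_k(p)$. A $k$-quasiconformal extension of $f$ to $\widehat{\mathbb C}$ is given by setting $$f(z)=\frac{1}{z-p}+\omega(1/\bar z)\qquad\text{for } |z|>1.$$
   Context: $\widehat{\mathbb C}=\mathbb C\cup\{\infty\}$ is the extended complex plane and $\mathbb D=\{z\in\mathbb C:|z|<1\}$. For $p\in[0,1)$, $\Sigma(p)$ is the class of meromorphic univalent (injective) functions $f$ in $\mathbb D$ with a simple pole at $z=p$ of residue $1$. For $0\le k<1$, a mapping $F:\widehat{\mathbb C}\to\widehat{\mathbb C}$ is called $k$-quasiconformal if $F$ is a homeomorphism and has locally $L^2$ distributional derivatives on $\mathbb C\setminus\{F^{-1}(\infty)\}$ satisfying $|\bar\partial F|\le k|\partial F|$ a.e., where $\partial F=\partial F/\partial z$ and $\bar\partial F=\partial F/\partial\bar z$. $\Sigma_k(p)$ is the class of those $f\in\Sigma(p)$ which admit a $k$-quasiconformal extension to $\widehat{\mathbb C}$, i.e. for which there is a $k$-quasiconformal $F:\widehat{\mathbb C}\to\widehat{\mathbb C}$ with $F|_{\mathbb D}=f$. In the formula for the extension, the values on the unit circle $|z|=1$ and at $z=\infty$ are understood by continuity. *)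

theory Defs
  imports "HOL-Complex_Analysis.Complex_Analysis"
begin

text \<open>The extended complex plane is \<^typ>\<open>complex option\<close>, with \<^term>\<open>None\<close> as the point at infinity.\<close>

definition sphere_top :: "complex option topology" where
  "sphere_top = Alexandroff_compactification euclidean"

text \<open>The value 0 at infinity matches the value that \<^term>\<open>(nicely_meromorphic_on)\<close> prescribes at poles.\<close>

definition finite_part :: "('a \<Rightarrow> complex option) \<Rightarrow> 'a \<Rightarrow> complex" where
  "finite_part f z = (case f z of None \<Rightarrow> 0 | Some w \<Rightarrow> w)"

definition sphere_meromorphic_on :: "(complex \<Rightarrow> complex option) \<Rightarrow> complex set \<Rightarrow> bool" where
  "sphere_meromorphic_on f A \<longleftrightarrow>
     finite_part f nicely_meromorphic_on A \<and> (\<forall>z\<in>A. f z = None \<longleftrightarrow> is_pole (finite_part f) z)"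

text \<open>Only the values on the unit disc matter for membership in the following class.
  \<^term>\<open>zorder f p = -1\<close> says that the pole is simple. There is no other pole, by injectivity.\<close>

definition Sigma_class :: "real \<Rightarrow> (complex \<Rightarrow> complex option) set" where
  "Sigma_class p = {f. sphere_meromorphic_on f (ball 0 1) \<and> inj_on f (ball 0 1) \<and>
     is_pole (finite_part f) (of_real p) \<and> zorder (finite_part f) (of_real p) = -1 \<and>
     residue (finite_part f) (of_real p) = 1}"

definition locally_Lp :: "nat \<Rightarrow> complex set \<Rightarrow> (complex \<Rightarrow> complex) \<Rightarrow> bool" where
  "locally_Lp q \<Omega> g \<longleftrightarrow> (\<forall>K. compact K \<longrightarrow> K \<subseteq> \<Omega> \<longrightarrow>
     set_borel_measurable lebesgue K g \<and> set_integrable lebesgue K (\<lambda>z. norm (g z) ^ q))"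

text \<open>\<^term>\<open>frechet_derivative \<phi> (at z) e\<close> is the (real) directional derivative of \<open>\<phi>\<close> at \<open>z\<close>
  in direction \<open>e\<close>; the directions 1 and \<^term>\<open>\<i>\<close> give the partial derivatives in x and y.\<close>

fun C_k :: "nat \<Rightarrow> (complex \<Rightarrow> complex) \<Rightarrow> bool" where
  "C_k 0 \<phi> \<longleftrightarrow> continuous_on UNIV \<phi>"
| "C_k (Suc n) \<phi> \<longleftrightarrow> (\<forall>z. \<phi> differentiable (at z)) \<and>
     (\<forall>e. C_k n (\<lambda>z. frechet_derivative \<phi> (at z) e))"

definition test_functions :: "complex set \<Rightarrow> (complex \<Rightarrow> complex) set" where
  "test_functions \<Omega> = {\<phi>. (\<forall>n. C_k n \<phi>) \<and> (\<exists>K. compact K \<and> K \<subseteq> \<Omega> \<and> (\<forall>z. z \<notin> K \<longrightarrow> \<phi> z = 0))}"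

definition has_distr_deriv ::
  "complex set \<Rightarrow> complex \<Rightarrow> (complex \<Rightarrow> complex) \<Rightarrow> (complex \<Rightarrow> complex) \<Rightarrow> bool" where
  "has_distr_deriv \<Omega> e u g \<longleftrightarrow> locally_Lp 1 \<Omega> u \<and> locally_Lp 1 \<Omega> g \<and>
     (\<forall>\<phi>\<in>test_functions \<Omega>.
        (LINT z:\<Omega>|lebesgue. u z * frechet_derivative \<phi> (at z) e) = - (LINT z:\<Omega>|lebesgue. g z * \<phi> z))"

text \<open>Below, \<open>Fx\<close> and \<open>Fy\<close> are the distributional partial derivatives of \<open>F\<close>, so that
  \<open>(Fx - \<i> Fy) / 2\<close> is the derivative with respect to \<open>z\<close> and \<open>(Fx + \<i> Fy) / 2\<close> the one
  with respect to the conjugate of \<open>z\<close>.\<close>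

definition quasiconformal :: "real \<Rightarrow> (complex option \<Rightarrow> complex option) \<Rightarrow> bool" where
  "quasiconformal k F \<longleftrightarrow> homeomorphic_map sphere_top sphere_top F \<and>
     (let \<Omega> = {z. F (Some z) \<noteq> None}; u = finite_part (\<lambda>z. F (Some z)) in
        \<exists>Fx Fy. has_distr_deriv \<Omega> 1 u Fx \<and> has_distr_deriv \<Omega> \<i> u Fy \<and>
          locally_Lp 2 \<Omega> Fx \<and> locally_Lp 2 \<Omega> Fy \<and>
          (AE z in lebesgue. z \<in> \<Omega> \<longrightarrow>
             cmod ((Fx z + \<i> * Fy z) / 2) \<le> k * cmod ((Fx z - \<i> * Fy z) / 2)))"

definition qc_extension ::
  "real \<Rightarrow> (complex \<Rightarrow> complex option) \<Rightarrow> (complex option \<Rightarrow> complex option) \<Rightarrow> bool" where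
  "qc_extension k f F \<longleftrightarrow> quasiconformal k F \<and> (\<forall>z\<in>ball 0 1. F (Some z) = f z)"

definition Sigma_k_class :: "real \<Rightarrow> real \<Rightarrow> (complex \<Rightarrow> complex option) set" where
  "Sigma_k_class k p = {f \<in> Sigma_class p. \<exists>F. qc_extension k f F}"

end

theory Submission
  imports Defs
begin

text \<open>
  The idea is to look at the extended function in the coordinate \<open>\<zeta> = 1 / (z - p)\<close>, which moves
  the pole to infinity. There it becomes \<open>\<zeta> \<mapsto> \<zeta> + q \<zeta>\<close>, where \<open>q\<close> is \<open>\<omega>\<close>, continued by
  reflection in the unit circle and expressed in terms of \<open>\<zeta>\<close>. The bound
  \<open>k / (1 + p)\<^sup>2\<close> on \<open>\<omega>'\<close> is what makes \<open>q\<close> Lipschitz with constant \<open>k\<close> on the whole plane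
  (\<open>lipschitz_pole_chart\<close>): the substitutions \<open>\<zeta> \<mapsto> p + 1 / \<zeta>\<close> in the disc and
  \<open>\<zeta> \<mapsto> \<zeta> / (1 + p * \<zeta>)\<close> outside it stretch distances at most by \<open>(1 + p)\<^sup>2\<close>. As
  \<open>k < 1\<close>, the map \<open>\<zeta> \<mapsto> \<zeta> + q \<zeta>\<close> is the identity plus a contraction, so by Banach's fixed
  point theorem it is a proper bijection of the plane (\<open>id_plus_contraction\<close>), and it extends to a
  homeomorphism of the sphere. Univalence of \<open>f\<close> is a by-product.

  The extension is locally Lipschitz away from the pole and real differentiable off the unit circle.
  Hence its distributional derivatives are the pointwise ones
  (\<open>locally_lipschitz_directional_derivative\<close>). For a locally Lipschitz function this can be seen
  without integrating along lines: the integral of a difference quotient of a compactly supported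
  function vanishes by translation invariance, and dominated convergence passes to the derivative.
  The dilatation condition is then a pointwise inequality. It is trivial in the disc, where the map is
  holomorphic; for \<open>\<bar>z\<bar> > 1\<close> it reads
  \<open>\<bar>\<omega>' (1 / cnj z)\<bar> / \<bar>z\<bar>\<^sup>2 \<le> k / \<bar>z - p\<bar>\<^sup>2\<close>, which follows from
  \<open>\<bar>z - p\<bar> \<le> (1 + p) * \<bar>z\<bar>\<close>.
\<close>

section \<open>Lipschitz maps and small perturbations of the identity\<close>

text \<open>A segment from a point of \<open>A\<close> to a point of \<open>B\<close> is connected and therefore passes through a common
  point of the two closed sets. Since that point lies on the segment, the two Lipschitz estimates
  add up without loss in the constant, which has to stay below 1 in the application.\<close>

lemma lipschitz_on_convex_closed_Un:
  fixes f :: "'a::euclidean_space \<Rightarrow> 'b::metric_space"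
  assumes "closed A" "closed B" "convex (A \<union> B)"
    and A: "L-lipschitz_on A f" and B: "L-lipschitz_on B f"
  shows "L-lipschitz_on (A \<union> B) f"
proof -
  have mixed: "dist (f x) (f y) \<le> L * dist x y" if "x \<in> A" "y \<in> B" for x y
  proof -
    have seg: "closed_segment x y \<subseteq> A \<union> B"
      using that assms(3) by (simp add: closed_segment_subset)
    have "A \<inter> closed_segment x y \<inter> (B \<inter> closed_segment x y) \<noteq> {}"
    proof
      assume *: "A \<inter> closed_segment x y \<inter> (B \<inter> closed_segment x y) = {}"
      have "connected (closed_segment x y)"
        by simp
      moreover have "A \<inter> B \<inter> closed_segment x y = {}"
        using * by blast
      moreover have "A \<inter> closed_segment x y \<noteq> {}" "B \<inter> closed_segment x y \<noteq> {}"
        using that by auto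
      ultimately show False
        using connected_closedD[OF _ _ seg \<open>closed A\<close> \<open>closed B\<close>] by blast
    qed
    then obtain c where c: "c \<in> A" "c \<in> B" "c \<in> closed_segment x y"
      by blast
    have "dist (f x) (f y) \<le> dist (f x) (f c) + dist (f c) (f y)"
      by (rule dist_triangle)
    also have "\<dots> \<le> L * dist x c + L * dist c y"
      using c that lipschitz_onD[OF A] lipschitz_onD[OF B] by (intro add_mono) auto
    also have "\<dots> = L * dist x y"
      using c(3) by (simp add: between_mem_segment[symmetric] between distrib_left)
    finally show ?thesis .
  qed
  show ?thesis
  proof (rule lipschitz_onI)
    fix x y assume "x \<in> A \<union> B" "y \<in> A \<union> B"
    then show "dist (f x) (f y) \<le> L * dist x y"
      using lipschitz_onD[OF A] lipschitz_onD[OF B] mixed[of x y] mixed[of y x]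
      by (auto simp: dist_commute)
  qed (rule lipschitz_on_nonneg[OF A])
qed

text \<open>Expansion follows from the triangle inequality; it gives injectivity. The equation
  \<open>x + q x = y\<close> says that \<open>x\<close> is a fixed point of the contraction \<open>x \<mapsto> y - q x\<close>.\<close>

lemma id_plus_contraction:
  fixes q :: "'a::{banach} \<Rightarrow> 'a"
  assumes q: "k-lipschitz_on UNIV q" and "k < 1"
  shows id_plus_contraction_expands: "(1 - k) * dist x y \<le> dist (x + q x) (y + q y)"
    and id_plus_contraction_bij: "bij (\<lambda>x. x + q x)"
proof -
  have exp: "(1 - k) * dist x y \<le> dist (x + q x) (y + q y)" for x y
  proof -
    have "dist x y - dist (q x) (q y) \<le> dist (x + q x) (y + q y)"
      unfolding dist_norm using norm_triangle_ineq2[of "x - y" "q y - q x"]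
      by (simp add: algebra_simps norm_minus_commute)
    moreover have "dist (q x) (q y) \<le> k * dist x y"
      using lipschitz_onD[OF q] by blast
    ultimately show ?thesis
      by (simp add: algebra_simps)
  qed
  then show "(1 - k) * dist x y \<le> dist (x + q x) (y + q y)" .
  have "inj (\<lambda>x. x + q x)"
  proof (rule injI)
    fix x y assume "x + q x = y + q y"
    then have "(1 - k) * dist x y \<le> 0"
      using exp[of x y] by simp
    then show "x = y"
      using \<open>k < 1\<close> by (simp add: mult_le_0_iff)
  qed
  moreover have "\<exists>x. x + q x = y" for y
  proof -
    have "\<exists>!x. y - q x = x"
      using lipschitz_onD[OF q] lipschitz_on_nonneg[OF q] \<open>k < 1\<close>
      by (intro banach_fix_type[of k]) (auto simp: dist_norm norm_minus_commute)
    then show ?thesis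
      by (metis diff_add_cancel)
  qed
  then have "surj (\<lambda>x. x + q x)"
    by (metis surjI)
  ultimately show "bij (\<lambda>x. x + q x)"
    by (simp add: bij_def)
qed

lemma bounded_vimage_expanding:
  fixes f :: "'a::metric_space \<Rightarrow> 'b::metric_space"
  assumes exp: "\<And>x y. c * dist x y \<le> dist (f x) (f y)" and "c > 0" and "bounded B"
  shows "bounded (f -` B)"
proof -
  obtain a :: 'a where True by simp
  obtain r where r: "\<And>y. y \<in> B \<Longrightarrow> dist (f a) y \<le> r"
    using \<open>bounded B\<close> unfolding bounded_any_center[where a = "f a"] by blast
  have "dist a x \<le> r / c" if "x \<in> f -` B" for x
    using order_trans[OF exp[of a x] r] that \<open>c > 0\<close> by (auto simp: field_simps)
  then show ?thesis
    unfolding bounded_def by blast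
qed

section \<open>Self-homeomorphisms of the Riemann sphere\<close>

lemma topspace_sphere_top [simp]: "topspace sphere_top = UNIV"
  by (simp add: sphere_top_def UNIV_option_conv)

text \<open>A neighbourhood of infinity is the complement of a compact set of the plane; compactness splits
  into closedness, which is part of \<open>open (Some -` U)\<close>, and boundedness.\<close>

lemma openin_sphere_top:
  "openin sphere_top U \<longleftrightarrow>
     open (Some -` U) \<and> (None \<in> U \<longrightarrow> bounded (- (Some -` U)))"
proof -
  have 1: "U = Some ` V \<longleftrightarrow> None \<notin> U \<and> V = Some -` U" for V
    by (auto simp: image_iff) (metis option.exhaust)
  have 2: "U = insert None (Some ` (UNIV - C)) \<longleftrightarrow> None \<in> U \<and> C = - (Some -` U)" for C
    by (auto simp: image_iff)
  show ?thesis
    unfolding sphere_top_def openin_Alexandroff_compactification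
    by (auto simp: 1 2 compact_eq_bounded_closed closed_def bounded_empty)
qed

text \<open>The sphere is compact and Hausdorff, so continuity of the inverse is automatic.\<close>

lemma homeomorphic_map_sphere_top:
  assumes "continuous_map sphere_top sphere_top F" "bij F"
  shows "homeomorphic_map sphere_top sphere_top F"
proof (rule continuous_imp_homeomorphic_map)
  show "compact_space sphere_top" "Hausdorff_space sphere_top"
    by (simp_all add: sphere_top_def Hausdorff_space_Alexandroff_compactification
        locally_compact_space_euclidean)
qed (use assms in \<open>auto simp: bij_def\<close>)

text \<open>Properness, expressed by preimages of bounded sets, is continuity at infinity.\<close>

lemma continuous_map_sphere_map_option:
  assumes cont: "continuous_on UNIV h"
    and proper: "\<And>B. bounded B \<Longrightarrow> bounded (h -` B)"
  shows "continuous_map sphere_top sphere_top (map_option h)"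
  unfolding continuous_map_def
proof (intro conjI allI impI)
  fix U assume "openin sphere_top U"
  then have U: "open (Some -` U)" "None \<in> U \<Longrightarrow> bounded (- (Some -` U))"
    by (auto simp: openin_sphere_top)
  have eq: "Some -` {x \<in> topspace sphere_top. map_option h x \<in> U} = h -` (Some -` U)"
    by auto
  show "openin sphere_top {x \<in> topspace sphere_top. map_option h x \<in> U}"
    unfolding openin_sphere_top eq
    using open_vimage[OF U(1) cont] proper[OF U(2)] by (auto simp: vimage_Compl)
qed auto

lemma bij_map_option: "bij f \<Longrightarrow> bij (map_option f)"
proof (rule o_bij)
  assume "bij f"
  show "map_option (inv f) \<circ> map_option f = id" "map_option f \<circ> map_option (inv f) = id"
    using \<open>bij f\<close> by (auto simp: fun_eq_iff option.map_comp o_def option.map_ident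
        bij_is_inj bij_is_surj surj_f_inv_f)
qed

definition sphere_inverse :: "complex option \<Rightarrow> complex option" where
  "sphere_inverse x =
     (case x of None \<Rightarrow> Some 0 | Some z \<Rightarrow> if z = 0 then None else Some (1 / z))"

lemma sphere_inverse_involution [simp]: "sphere_inverse (sphere_inverse x) = x"
  by (cases x) (auto simp: sphere_inverse_def)

lemma continuous_map_sphere_inverse: "continuous_map sphere_top sphere_top sphere_inverse"
  unfolding continuous_map_def
proof (intro conjI allI impI)
  fix U assume "openin sphere_top U"
  then have U: "open (Some -` U)" "None \<in> U \<Longrightarrow> bounded (- (Some -` U))"
    by (auto simp: openin_sphere_top)
  let ?V = "Some -` {x \<in> topspace sphere_top. sphere_inverse x \<in> U}"
  have V: "z \<in> ?V \<longleftrightarrow> (if z = 0 then None \<in> U else Some (1 / z) \<in> U)" for z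
    by (auto simp: sphere_inverse_def)
  have nonzero: "open (- {0} \<inter> (\<lambda>z. 1 / z) -` (Some -` U))"
    by (rule continuous_open_preimage) (auto intro!: continuous_intros U)
  \<comment> \<open>The origin is sent to infinity, so it is interior to \<open>?V\<close> if \<open>U\<close> is a neighbourhood of infinity:
    points of modulus below \<open>1 / b\<close> are sent beyond the bound \<open>b\<close> for the complement of \<open>U\<close>.\<close>
  have "open ?V"
  proof (cases "None \<in> U")
    case True
    then obtain b where b: "b > 0" "\<And>z. z \<notin> Some -` U \<Longrightarrow> norm z \<le> b"
      using U(2) by (meson ComplI bounded_pos)
    have "?V = (- {0} \<inter> (\<lambda>z. 1 / z) -` (Some -` U)) \<union> ball 0 (1 / b)"
    proof (intro set_eqI)
      fix z
      have "Some (1 / z) \<in> U" if "z \<noteq> 0" "norm z < 1 / b"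
      proof (rule ccontr)
        assume "Some (1 / z) \<notin> U"
        then have "norm (1 / z) \<le> b"
          using b(2) by auto
        then show False
          using that b(1) by (simp add: norm_divide field_simps)
      qed
      then show "z \<in> ?V \<longleftrightarrow> z \<in> (- {0} \<inter> (\<lambda>z. 1 / z) -` (Some -` U)) \<union> ball 0 (1 / b)"
        unfolding V using True b(1) by auto
    qed
    then show ?thesis
      using nonzero by (metis open_Un open_ball)
  next
    case False
    then have "?V = - {0} \<inter> (\<lambda>z. 1 / z) -` (Some -` U)"
      unfolding set_eq_iff V by auto
    then show ?thesis
      using nonzero by metis
  qed
  \<comment> \<open>Infinity is sent to the origin: points of modulus above \<open>1 / e\<close> are sent into the ball of
    radius \<open>e\<close>.\<close>
  moreover have "bounded (- ?V)" if "None \<in> {x \<in> topspace sphere_top. sphere_inverse x \<in> U}"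
  proof -
    have "0 \<in> Some -` U"
      using that by (simp add: sphere_inverse_def)
    then obtain e where e: "e > 0" "ball 0 e \<subseteq> Some -` U"
      using U(1) open_contains_ball by blast
    have "norm z \<le> 1 / e" if "z \<in> - ?V" for z
    proof (rule ccontr)
      assume "\<not> norm z \<le> 1 / e"
      then have *: "norm z > 1 / e" "z \<noteq> 0"
        using e(1) by auto
      then have "1 / z \<in> ball 0 e"
        using e(1) by (simp add: norm_divide field_simps)
      then show False
        using e(2) * that unfolding Compl_iff V by auto
    qed
    then show ?thesis
      unfolding bounded_iff by blast
  qed
  ultimately show "openin sphere_top {x \<in> topspace sphere_top. sphere_inverse x \<in> U}"
    unfolding openin_sphere_top by blast
qed auto

section \<open>Continuation by reflection in the unit circle\<close>

lemma inverse_cnj_unit: "cmod z = 1 \<Longrightarrow> 1 / cnj z = z"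
  using complex_norm_square[of z] by (cases "z = 0") (auto simp: field_simps)

lemma reflection_in_ball: "cmod z > 1 \<Longrightarrow> 1 / cnj z \<in> ball 0 1"
  by (simp add: norm_divide divide_less_eq_1)

definition reflect_ext :: "(complex \<Rightarrow> complex) \<Rightarrow> complex \<Rightarrow> complex" where
  "reflect_ext w z = (if cmod z \<le> 1 then w z else w (1 / cnj z))"

text \<open>Reflection in the unit circle does not increase distances outside the disc, so the Lipschitz
  constant on the closed disc is inherited by the exterior, and the two pieces are glued.\<close>

lemma lipschitz_reflect_ext:
  assumes w: "M-lipschitz_on (cball 0 1) w"
  shows "M-lipschitz_on UNIV (reflect_ext w)"
proof -
  have "M-lipschitz_on {z. 1 \<le> cmod z} (reflect_ext w)"
  proof (rule lipschitz_onI)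
    fix x y :: complex assume "x \<in> {z. 1 \<le> cmod z}" "y \<in> {z. 1 \<le> cmod z}"
    then have xy: "cmod x \<ge> 1" "cmod y \<ge> 1" "x \<noteq> 0" "y \<noteq> 0"
      by auto
    \<comment> \<open>On the circle both formulas agree, so the second one may be used on the closed exterior.\<close>
    have on_circle: "reflect_ext w z = w (1 / cnj z)" if "cmod z \<ge> 1" for z
      using that inverse_cnj_unit[of z] by (auto simp: reflect_ext_def)
    have "dist (w (1 / cnj x)) (w (1 / cnj y)) \<le> M * dist (1 / cnj x) (1 / cnj y)"
      using xy by (intro lipschitz_onD[OF w]) (auto simp: norm_divide)
    also have "dist (1 / cnj x) (1 / cnj y) = dist x y / (cmod x * cmod y)"
    proof -
      have "1 / cnj x - 1 / cnj y = cnj ((y - x) / (x * y))"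
        using xy by (simp add: field_simps)
      then show ?thesis
        unfolding dist_norm by (metis complex_mod_cnj norm_divide norm_minus_commute norm_mult)
    qed
    also have "M * (dist x y / (cmod x * cmod y)) \<le> M * dist x y"
    proof (rule mult_left_mono)
      have "1 \<le> cmod x * cmod y"
        using mult_mono[of 1 "cmod x" 1 "cmod y"] xy by simp
      then show "dist x y / (cmod x * cmod y) \<le> dist x y"
        using divide_left_mono[of 1 "cmod x * cmod y" "dist x y"] by simp
    qed (rule lipschitz_on_nonneg[OF w])
    finally show "dist (reflect_ext w x) (reflect_ext w y) \<le> M * dist x y"
      using xy by (simp add: on_circle)
  qed (rule lipschitz_on_nonneg[OF w])
  moreover have "M-lipschitz_on (cball 0 1) (reflect_ext w)"
    by (rule lipschitz_on_transform[OF w]) (auto simp: reflect_ext_def)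
  moreover have "cball 0 1 \<union> {z::complex. 1 \<le> cmod z} = UNIV"
    by auto
  moreover have "closed {z::complex. 1 \<le> cmod z}"
    by (intro closed_Collect_le continuous_intros)
  ultimately show ?thesis
    using lipschitz_on_convex_closed_Un[of "cball 0 1" "{z. 1 \<le> cmod z}" M "reflect_ext w"]
    by simp
qed

lemma reflect_ext_has_derivative_inside:
  assumes "w holomorphic_on ball 0 1" "cmod z < 1"
  shows "(reflect_ext w has_derivative (\<lambda>h. deriv w z * h)) (at z)"
proof (rule has_derivative_transform_within_open)
  show "(w has_derivative (\<lambda>h. deriv w z * h)) (at z)"
    using holomorphic_derivI[OF assms(1) open_ball, of z] assms(2)
    by (simp add: has_field_derivative_def)
  show "open (ball 0 1 :: complex set)"
    by (rule open_ball)
qed (use assms(2) in \<open>auto simp: reflect_ext_def\<close>)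

text \<open>Outside the disc the function is antiholomorphic: its derivative is a multiple of \<open>cnj h\<close>.\<close>

lemma reflect_ext_has_derivative_outside:
  assumes "w holomorphic_on ball 0 1" "cmod z > 1"
  shows "(reflect_ext w has_derivative (\<lambda>h. - deriv w (1 / cnj z) / (cnj z)\<^sup>2 * cnj h)) (at z)"
proof (rule has_derivative_transform_within_open)
  have "z \<noteq> 0"
    using assms(2) by auto
  have "(w has_field_derivative deriv w (1 / cnj z)) (at (1 / cnj z))"
    by (intro holomorphic_derivI[OF assms(1) open_ball] reflection_in_ball assms(2))
  moreover have "((\<lambda>\<zeta>. 1 / \<zeta>) has_field_derivative - 1 / (cnj z)\<^sup>2) (at (cnj z))"
    using \<open>z \<noteq> 0\<close> by (auto intro!: derivative_eq_intros simp: power2_eq_square)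
  ultimately have "((\<lambda>\<zeta>. w (1 / \<zeta>)) has_field_derivative - deriv w (1 / cnj z) / (cnj z)\<^sup>2) (at (cnj z))"
    using DERIV_chain2 by fastforce
  then have *: "((\<lambda>\<zeta>. w (1 / \<zeta>)) has_derivative (\<lambda>h. - deriv w (1 / cnj z) / (cnj z)\<^sup>2 * h)) (at (cnj z))"
    unfolding has_field_derivative_def .
  have "(cnj has_derivative cnj) (at z)"
    by (rule bounded_linear_imp_has_derivative[OF bounded_linear_cnj])
  from has_derivative_compose[OF this *]
  show "((\<lambda>z. w (1 / cnj z)) has_derivative (\<lambda>h. - deriv w (1 / cnj z) / (cnj z)\<^sup>2 * cnj h)) (at z)" .
  show "open {z::complex. 1 < cmod z}"
    by (intro open_Collect_less continuous_intros)
qed (use assms(2) in \<open>auto simp: reflect_ext_def\<close>)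

section \<open>The extension in the coordinate with the pole at infinity\<close>

text \<open>This is the continuation of \<open>w\<close> in the coordinate \<open>\<zeta> = 1 / (z - p)\<close>; the value at
  \<open>\<zeta> = 0\<close> belongs to \<open>z = \<infinity>\<close>, whose reflection is the origin.\<close>

definition pole_chart :: "real \<Rightarrow> (complex \<Rightarrow> complex) \<Rightarrow> complex \<Rightarrow> complex" where
  "pole_chart p w \<zeta> = (if \<zeta> = 0 then w 0 else reflect_ext w (of_real p + 1 / \<zeta>))"

text \<open>The circle \<open>\<bar>z\<bar> = 1\<close> becomes \<open>\<bar>\<zeta>\<bar> = \<bar>1 + p * \<zeta>\<bar>\<close>. The set \<open>A\<close> corresponds to the exterior of the unit disc
  and \<open>B\<close> to the disc itself. On \<open>A\<close> the function is \<open>w\<close> after \<open>\<zeta> \<mapsto> cnj (\<zeta> / (1 + p * \<zeta>))\<close>, on \<open>B\<close> it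
  is \<open>w\<close> after \<open>\<zeta> \<mapsto> p + 1 / \<zeta>\<close>. Both substitutions are Moebius maps up to conjugation, and
  such a map multiplies the distance of two points exactly by the product of two factors, one for each
  point, here \<open>1 / \<bar>1 + p * \<zeta>\<bar>\<close> or \<open>1 / \<bar>\<zeta>\<bar>\<close>. The inequality
  \<open>1 \<le> \<bar>1 + p * \<zeta>\<bar> + p * \<bar>\<zeta>\<bar>\<close> bounds whichever is relevant by \<open>1 + p\<close>.\<close>

lemma lipschitz_pole_chart:
  assumes w: "(k / (1 + p)\<^sup>2)-lipschitz_on (cball 0 1) w" and p: "0 \<le> p" "p < 1"
  shows "k-lipschitz_on UNIV (pole_chart p w)"
proof -
  define P where "P = complex_of_real p"
  define A B where "A = {\<zeta>. cmod \<zeta> \<le> cmod (1 + P * \<zeta>)}" and "B = {\<zeta>. cmod (1 + P * \<zeta>) \<le> cmod \<zeta>}"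
  have P: "cmod P = p" "cnj P = P"
    using p by (auto simp: P_def)
  have k: "0 \<le> k"
    using lipschitz_on_nonneg[OF w] p by (simp add: zero_le_divide_iff)
  have tri: "1 \<le> cmod (1 + P * \<zeta>) + p * cmod \<zeta>" for \<zeta>
    using norm_triangle_ineq4[of "1 + P * \<zeta>" "P * \<zeta>"] P by (simp add: norm_mult)
  \<comment> \<open>\<open>1 / c\<close> and \<open>1 / d\<close> are the factors of the substitution at the two points.\<close>
  have scale: "dist (w a) (w b) \<le> k * dist x y"
    if "a \<in> cball 0 1" "b \<in> cball 0 1" "dist a b = dist x y / (c * d)"
      "1 \<le> (1 + p) * c" "1 \<le> (1 + p) * d" for a b x y c d
  proof -
    have cd: "c > 0" "d > 0"
      using that(4,5) p by (smt (verit) mult_nonneg_nonpos)+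
    have "1 * 1 \<le> ((1 + p) * c) * ((1 + p) * d)"
      by (rule mult_mono) (use that in auto)
    then have *: "1 \<le> (1 + p)\<^sup>2 * (c * d)"
      by (simp add: power2_eq_square mult_ac)
    have "dist (w a) (w b) \<le> k / (1 + p)\<^sup>2 * (dist x y / (c * d))"
      using lipschitz_onD[OF w that(1,2)] that(3) by simp
    also have "\<dots> = k * dist x y / ((1 + p)\<^sup>2 * (c * d))"
      by simp
    also have "\<dots> \<le> k * dist x y / 1"
      using * k by (intro divide_left_mono) auto
    finally show ?thesis by simp
  qed
  have "k-lipschitz_on A (pole_chart p w)"
  proof (rule lipschitz_onI)
    have *: "1 + P * \<zeta> \<noteq> 0" "1 \<le> (1 + p) * cmod (1 + P * \<zeta>)"
      "cnj (\<zeta> / (1 + P * \<zeta>)) \<in> cball 0 1" "pole_chart p w \<zeta> = w (cnj (\<zeta> / (1 + P * \<zeta>)))"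
      if "\<zeta> \<in> A" for \<zeta>
    proof -
      show nz: "1 + P * \<zeta> \<noteq> 0"
        using that by (auto simp: A_def)
      have "p * cmod \<zeta> \<le> p * cmod (1 + P * \<zeta>)"
        using that p by (intro mult_left_mono) (auto simp: A_def)
      then show "1 \<le> (1 + p) * cmod (1 + P * \<zeta>)"
        using tri[of \<zeta>] by (simp add: distrib_right)
      show "cnj (\<zeta> / (1 + P * \<zeta>)) \<in> cball 0 1"
        using that nz by (simp add: A_def norm_divide del: complex_cnj_divide)
      show "pole_chart p w \<zeta> = w (cnj (\<zeta> / (1 + P * \<zeta>)))"
      proof (cases "\<zeta> = 0")
        case False
        then have z: "P + 1 / \<zeta> = (1 + P * \<zeta>) / \<zeta>"
          by (simp add: field_simps)
        have eq: "1 / cnj (P + 1 / \<zeta>) = cnj (\<zeta> / (1 + P * \<zeta>))"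
          unfolding z by simp
        have ge: "cmod (P + 1 / \<zeta>) \<ge> 1"
          unfolding z using that False by (simp add: A_def norm_divide)
        show ?thesis
          using False ge inverse_cnj_unit[of "P + 1 / \<zeta>"] unfolding pole_chart_def reflect_ext_def P_def[symmetric] eq by auto
      qed (simp add: pole_chart_def)
    qed
    fix x y assume xy: "x \<in> A" "y \<in> A"
    have "x / (1 + P * x) - y / (1 + P * y) = (x - y) / ((1 + P * x) * (1 + P * y))"
      using *(1)[OF xy(1)] *(1)[OF xy(2)] by (simp add: field_simps)
    then have "dist (cnj (x / (1 + P * x))) (cnj (y / (1 + P * y)))
        = dist x y / (cmod (1 + P * x) * cmod (1 + P * y))"
      unfolding dist_norm complex_cnj_diff[symmetric] complex_mod_cnj
      by (simp add: norm_divide norm_mult)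
    then show "dist (pole_chart p w x) (pole_chart p w y) \<le> k * dist x y"
      unfolding *(4)[OF xy(1)] *(4)[OF xy(2)]
      by (intro scale) (use * xy in blast)+
  qed fact
  moreover have "k-lipschitz_on B (pole_chart p w)"
  proof (rule lipschitz_onI)
    have *: "\<zeta> \<noteq> 0" "1 \<le> (1 + p) * cmod \<zeta>"
      "P + 1 / \<zeta> \<in> cball 0 1" "pole_chart p w \<zeta> = w (P + 1 / \<zeta>)"
      if "\<zeta> \<in> B" for \<zeta>
    proof -
      show nz: "\<zeta> \<noteq> 0"
        using that by (auto simp: B_def)
      show "1 \<le> (1 + p) * cmod \<zeta>"
        using tri[of \<zeta>] that by (simp add: distrib_right B_def)
      have "P + 1 / \<zeta> = (1 + P * \<zeta>) / \<zeta>"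
        using nz by (simp add: field_simps)
      then show "P + 1 / \<zeta> \<in> cball 0 1"
        using that nz by (simp add: B_def norm_divide)
      then show "pole_chart p w \<zeta> = w (P + 1 / \<zeta>)"
        using nz by (simp add: pole_chart_def reflect_ext_def P_def)
    qed
    fix x y assume xy: "x \<in> B" "y \<in> B"
    have "(P + 1 / x) - (P + 1 / y) = (y - x) / (x * y)"
      using *(1)[OF xy(1)] *(1)[OF xy(2)] by (simp add: field_simps)
    then have "dist (P + 1 / x) (P + 1 / y) = dist x y / (cmod x * cmod y)"
      unfolding dist_norm by (simp add: norm_divide norm_mult norm_minus_commute)
    then show "dist (pole_chart p w x) (pole_chart p w y) \<le> k * dist x y"
      unfolding *(4)[OF xy(1)] *(4)[OF xy(2)]
      by (intro scale) (use * xy in blast)+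
  qed fact
  moreover have "closed A" "closed B"
    unfolding A_def B_def by (intro closed_Collect_le continuous_intros)+
  moreover have "A \<union> B = UNIV"
    by (auto simp: A_def B_def)
  ultimately show ?thesis
    using lipschitz_on_convex_closed_Un[of A B k "pole_chart p w"] by simp
qed

text \<open>The extension is factored into a translation, an inversion and a perturbation of the identity, so
  that continuity and bijectivity can be checked for each factor separately.\<close>

definition sphere_ext :: "real \<Rightarrow> (complex \<Rightarrow> complex) \<Rightarrow> complex option \<Rightarrow> complex option" where
  "sphere_ext p w = map_option (\<lambda>\<zeta>. \<zeta> + pole_chart p w \<zeta>) \<circ> sphere_inverse \<circ> map_option (\<lambda>z. z - of_real p)"

lemma sphere_ext_Some:
  "sphere_ext p w (Some z) =
     (if z = of_real p then None else Some (1 / (z - of_real p) + reflect_ext w z))"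
  by (simp add: sphere_ext_def sphere_inverse_def pole_chart_def)

lemma homeomorphic_map_sphere_ext:
  assumes w: "(k / (1 + p)\<^sup>2)-lipschitz_on (cball 0 1) w" and p: "0 \<le> p" "p < 1" and "k < 1"
  shows "homeomorphic_map sphere_top sphere_top (sphere_ext p w)"
proof (rule homeomorphic_map_sphere_top)
  note q = lipschitz_pole_chart[OF w p]
  have translation: "continuous_map sphere_top sphere_top (map_option (\<lambda>z. z - complex_of_real p))"
    by (rule continuous_map_sphere_map_option)
      (auto intro!: continuous_intros bounded_vimage_expanding[of 1] simp: dist_norm)
  have perturbation: "continuous_map sphere_top sphere_top (map_option (\<lambda>\<zeta>. \<zeta> + pole_chart p w \<zeta>))"
  proof (rule continuous_map_sphere_map_option)
    show "continuous_on UNIV (\<lambda>\<zeta>. \<zeta> + pole_chart p w \<zeta>)"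
      using lipschitz_on_continuous_on[OF q] by (intro continuous_intros)
    show "bounded ((\<lambda>\<zeta>. \<zeta> + pole_chart p w \<zeta>) -` B)" if "bounded B" for B
      using id_plus_contraction_expands[OF q \<open>k < 1\<close>] \<open>k < 1\<close> that
      by (intro bounded_vimage_expanding[of "1 - k"]) auto
  qed
  show "continuous_map sphere_top sphere_top (sphere_ext p w)"
    unfolding sphere_ext_def
    by (intro continuous_map_compose[OF translation] continuous_map_compose[OF continuous_map_sphere_inverse] perturbation)
  have "bij sphere_inverse"
    by (rule o_bij[of sphere_inverse]) auto
  moreover have "bij (\<lambda>z. z - complex_of_real p)"
    by (rule o_bij[of "\<lambda>z. z + complex_of_real p"]) auto
  ultimately show "bij (sphere_ext p w)"
    unfolding sphere_ext_def
    using id_plus_contraction_bij[OF q \<open>k < 1\<close>] by (intro bij_comp bij_map_option)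
qed

section \<open>Distributional derivatives of locally Lipschitz functions\<close>

lemma compact_thickening:
  fixes K \<Omega> :: "complex set"
  assumes "compact K" "open \<Omega>" "K \<subseteq> \<Omega>"
  obtains K' \<delta> where "compact K'" "K \<subseteq> K'" "K' \<subseteq> \<Omega>" "\<delta> > 0"
    "\<And>x y. x \<in> K \<Longrightarrow> dist x y \<le> \<delta> \<Longrightarrow> y \<in> K'"
proof -
  obtain \<delta> where "\<delta> > 0" "(\<Union>x\<in>K. cball x \<delta>) \<subseteq> \<Omega>"
    using compact_subset_open_imp_cball_epsilon_subset[OF assms] by metis
  moreover have "compact (\<Union>x\<in>K. cball x \<delta>)"
    by (rule compact_minkowski_sum_cball[OF \<open>compact K\<close>])
  ultimately show ?thesis
    by (intro that[of "\<Union>x\<in>K. cball x \<delta>" \<delta>]) (auto intro: less_imp_le)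
qed

lemma null_steps:
  fixes e :: complex
  assumes "\<delta> > 0"
  obtains t :: "nat \<Rightarrow> real"
  where "t \<longlonglongrightarrow> 0" "\<And>n. t n > 0" "\<And>n z. dist z (z + of_real (t n) * e) \<le> \<delta>"
proof
  let ?c = "\<delta> / (1 + cmod e)"
  let ?t = "\<lambda>n. ?c * inverse (real (Suc n))"
  have c: "?c > 0" "?c * cmod e \<le> \<delta>"
    using assms by (auto simp: field_simps add_pos_nonneg)
  show "?t \<longlonglongrightarrow> 0"
    using tendsto_mult[OF tendsto_const[of ?c] LIMSEQ_inverse_real_of_nat] by simp
  show pos: "?t n > 0" for n
    using c(1) by (intro mult_pos_pos) simp_all
  show "dist z (z + of_real (?t n) * e) \<le> \<delta>" for n z
  proof -
    have "?t n * cmod e \<le> ?c * cmod e"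
      using c(1) by (intro mult_right_mono mult_left_le) (auto simp: field_simps)
    moreover have "dist z (z + of_real r * e) = r * cmod e" if "r > 0" for r
      using that by (simp add: dist_norm norm_mult)
    ultimately show ?thesis
      using c(2) pos[of n] by (metis order_trans)
  qed
qed

lemma has_derivative_imp_directional:
  fixes f :: "complex \<Rightarrow> complex"
  assumes "(f has_derivative D) (at (z + of_real s * e))"
  shows "((\<lambda>t. f (z + of_real t * e)) has_vector_derivative D e) (at s)"
proof -
  have lin: "((\<lambda>t. z + complex_of_real t * e) has_derivative (\<lambda>t. of_real t * e)) (at s)"
    by (auto intro!: derivative_eq_intros)
  have "D (of_real t * e) = t *\<^sub>R D e" for t
    using linear_cmul[OF has_derivative_linear[OF assms], of t e] by (simp add: scaleR_conv_of_real)
  then show ?thesis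
    using has_derivative_compose[OF lin assms] by (simp add: has_vector_derivative_def)
qed

lemma has_vector_derivative_imp_quotient_LIMSEQ:
  fixes f :: "real \<Rightarrow> complex"
  assumes D: "(f has_vector_derivative D) (at 0)"
    and t: "t \<longlonglongrightarrow> 0" "\<And>n. t n > 0"
  shows "(\<lambda>n. (f (t n) - f 0) / of_real (t n)) \<longlonglongrightarrow> D"
proof -
  have lim: "((\<lambda>y. (f y - f 0 - y *\<^sub>R D) /\<^sub>R norm y) \<longlongrightarrow> 0) (at 0)"
    using D unfolding has_vector_derivative_def has_derivative_at_within by simp
  have "filterlim t (at 0) sequentially"
    using t by (simp add: filterlim_at order_less_imp_not_eq2)
  then have "(\<lambda>n. (f (t n) - f 0 - t n *\<^sub>R D) /\<^sub>R norm (t n)) \<longlonglongrightarrow> 0"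
    by (rule filterlim_compose[OF lim])
  moreover have "(f (t n) - f 0 - t n *\<^sub>R D) /\<^sub>R norm (t n) = (f (t n) - f 0) / of_real (t n) - D" for n
    using t(2)[of n] by (simp add: scaleR_conv_of_real field_simps)
  ultimately show ?thesis
    by (simp add: LIM_zero_iff)
qed

lemma borel_measurable_lebesgue_limit_off_negligible:
  fixes f :: "nat \<Rightarrow> 'a::euclidean_space \<Rightarrow> 'b::euclidean_space"
  assumes f: "\<And>n. f n \<in> borel_measurable lebesgue" and N: "negligible N"
    and lim: "\<And>x. x \<notin> N \<Longrightarrow> (\<lambda>n. f n x) \<longlonglongrightarrow> g x"
  shows "g \<in> borel_measurable lebesgue"
proof -
  have "N \<in> null_sets lebesgue"
    using N by (simp add: negligible_iff_null_sets)
  then have [measurable]: "N \<in> sets lebesgue" and AE: "AE x in lebesgue. x \<notin> N"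
    by (auto intro: AE_not_in)
  note f[measurable]
  have "(\<lambda>x. if x \<in> N then 0 else g x) \<in> borel_measurable lebesgue"
  proof (rule borel_measurable_LIMSEQ_metric)
    show "(\<lambda>x. if x \<in> N then 0 else f n x) \<in> borel_measurable lebesgue" for n
      by measurable
    show "(\<lambda>n. if x \<in> N then 0 else f n x) \<longlonglongrightarrow> (if x \<in> N then 0 else g x)" for x
      using lim by simp
  qed
  then show ?thesis
    by (rule borel_measurable_AE) (use AE in \<open>auto elim: eventually_mono\<close>)
qed

lemma set_borel_measurable_lebesgue_compact:
  fixes f :: "complex \<Rightarrow> complex"
  assumes "compact K" "continuous_on K f"
  shows "set_borel_measurable lebesgue K f"
  unfolding set_borel_measurable_def
  by (rule measurable_completion[OF borel_measurable_integrable[OF borel_integrable_compact[OF assms]]])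

lemma integrable_lborel_imp_lebesgue:
  fixes f :: "complex \<Rightarrow> 'b::{banach, second_countable_topology}"
  shows "integrable lborel f \<Longrightarrow> integrable lebesgue f"
  using integrable_completion[OF borel_measurable_integrable] by blast

text \<open>Compact sets have finite measure, so local essential boundedness gives every local integrability
  condition.\<close>

lemma locally_Lp_bounded:
  assumes meas: "\<And>K. compact K \<Longrightarrow> K \<subseteq> \<Omega> \<Longrightarrow> set_borel_measurable lebesgue K g"
    and bdd: "\<And>K. compact K \<Longrightarrow> K \<subseteq> \<Omega> \<Longrightarrow> \<exists>B. AE z in lebesgue. z \<in> K \<longrightarrow> cmod (g z) \<le> B"
  shows "locally_Lp q \<Omega> g"
  unfolding locally_Lp_def
proof (intro allI impI conjI)
  fix K :: "complex set" assume K: "compact K" "K \<subseteq> \<Omega>"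
  then obtain B where B: "AE z in lebesgue. z \<in> K \<longrightarrow> cmod (g z) \<le> B"
    using bdd by blast
  show m: "set_borel_measurable lebesgue K g"
    by (rule meas[OF K])
  have [measurable]: "K \<in> sets lebesgue"
    using K by (simp add: compact_imp_closed)
  have g[measurable]: "(\<lambda>z. indicator K z *\<^sub>R g z) \<in> borel_measurable lebesgue"
    using m by (simp add: set_borel_measurable_def)
  have "integrable lborel (\<lambda>z. indicator K z *\<^sub>R (B ^ q))"
    using K by (intro borel_integrable_compact) auto
  then have int: "integrable lebesgue (\<lambda>z. indicator K z *\<^sub>R (B ^ q))"
    by (rule integrable_lborel_imp_lebesgue)
  show "set_integrable lebesgue K (\<lambda>z. cmod (g z) ^ q)"
    unfolding set_integrable_def
  proof (rule Bochner_Integration.integrable_bound[OF int])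
    have "(\<lambda>z. indicator K z *\<^sub>R cmod (indicator K z *\<^sub>R g z) ^ q) \<in> borel_measurable lebesgue"
      by measurable
    also have "(\<lambda>z. indicator K z *\<^sub>R cmod (indicator K z *\<^sub>R g z) ^ q)
        = (\<lambda>z. indicator K z *\<^sub>R cmod (g z) ^ q)"
      by (auto simp: indicator_def)
    finally show "(\<lambda>z. indicator K z *\<^sub>R cmod (g z) ^ q) \<in> borel_measurable lebesgue" .
    show "AE z in lebesgue. norm (indicator K z *\<^sub>R cmod (g z) ^ q) \<le> norm (indicator K z *\<^sub>R (B ^ q))"
      using B by eventually_elim (auto simp: indicator_def intro!: order_trans[OF power_mono abs_ge_self])
  qed
qed

text \<open>This replaces integration by parts: Lebesgue measure is invariant under translation by \<open>a\<close>.\<close>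

lemma integral_difference_quotient_eq_0:
  fixes v :: "complex \<Rightarrow> complex"
  assumes "integrable lborel v"
  shows "integrable lborel (\<lambda>z. (v (z + a) - v z) / c)"
    and "(LINT z|lborel. (v (z + a) - v z) / c) = 0"
proof -
  have eq: "distr lborel borel ((+) a) = (lborel :: complex measure)"
    by (rule lborel_distr_plus)
  have m: "v \<in> borel_measurable borel"
    using borel_measurable_integrable[OF assms] by simp
  have "integrable (distr lborel borel ((+) a)) v"
    unfolding eq by (rule assms)
  then have int: "integrable lborel (\<lambda>z. v (z + a))"
    using m by (subst (asm) integrable_distr_eq) (auto simp: add.commute)
  then show "integrable lborel (\<lambda>z. (v (z + a) - v z) / c)"
    using assms by auto
  have "integral\<^sup>L (distr lborel borel ((+) a)) v = (LINT z|lborel. v (z + a))"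
    using m by (subst integral_distr) (auto simp: add.commute)
  then have "(LINT z|lborel. v (z + a)) = integral\<^sup>L lborel v"
    unfolding eq by simp
  then show "(LINT z|lborel. (v (z + a) - v z) / c) = 0"
    using int assms by simp
qed

lemma directional_derivative_vanishes_off_support:
  assumes "closed K" "\<And>z. z \<notin> K \<Longrightarrow> \<phi> z = 0" "z \<notin> K"
  shows "frechet_derivative \<phi> (at z) e = 0"
proof -
  have "(\<phi> has_derivative (\<lambda>_. 0)) (at z)"
    by (rule has_derivative_transform_within_open[of "\<lambda>_. 0" _ _ _ "- K"])
      (use assms in auto)
  from frechet_derivative_at[OF this] show ?thesis
    by metis
qed

text \<open>The derivative is an almost everywhere limit of difference quotients, which are continuous and
  bounded by the Lipschitz constant on compact sets; this gives measurability and local boundedness.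
  For integration by parts, let \<open>\<phi>\<close> be a test function. The product \<open>v = u * \<phi>\<close> has compact support, its
  difference quotients are uniformly bounded, live on one compact set and have integral 0; by dominated
  convergence, the limit \<open>u * D + g * \<phi>\<close> has integral 0, too.\<close>

lemma locally_lipschitz_directional_derivative:
  fixes u g :: "complex \<Rightarrow> complex"
  assumes "open \<Omega>" and N: "negligible N"
    and lip: "\<And>K. compact K \<Longrightarrow> K \<subseteq> \<Omega> \<Longrightarrow> \<exists>L. L-lipschitz_on K u"
    and deriv: "\<And>z. z \<in> \<Omega> - N \<Longrightarrow> ((\<lambda>t. u (z + of_real t * e)) has_vector_derivative g z) (at 0)"
  shows locally_lipschitz_imp_locally_Lp_deriv: "locally_Lp q \<Omega> g"
    and locally_lipschitz_imp_has_distr_deriv: "has_distr_deriv \<Omega> e u g"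
proof -
  have AE_N: "AE z in lebesgue. z \<notin> N"
    using N by (simp add: negligible_iff_null_sets AE_not_in)
  have quotient: "(\<lambda>n. (u (z + of_real (t n) * e) - u z) / of_real (t n)) \<longlonglongrightarrow> g z"
    if "z \<in> \<Omega> - N" "t \<longlonglongrightarrow> 0" "\<And>n. t n > 0" for z t
    using has_vector_derivative_imp_quotient_LIMSEQ[OF deriv that(2,3)] that(1) by simp
  have cont: "continuous_on K u" if "compact K" "K \<subseteq> \<Omega>" for K
    using lip[OF that] lipschitz_on_continuous_on by blast
  show g: "locally_Lp q \<Omega> g" for q
  proof (rule locally_Lp_bounded)
    fix K :: "complex set" assume K: "compact K" "K \<subseteq> \<Omega>"
    then obtain K' \<delta> where K': "compact K'" "K \<subseteq> K'" "K' \<subseteq> \<Omega>" and \<delta>: "\<delta> > 0"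
      "\<And>x y. x \<in> K \<Longrightarrow> dist x y \<le> \<delta> \<Longrightarrow> y \<in> K'"
      using compact_thickening \<open>open \<Omega>\<close> by blast
    obtain L where L: "L-lipschitz_on K' u"
      using lip K' by blast
    obtain t where t: "t \<longlonglongrightarrow> 0" "\<And>n. t n > 0" "\<And>n z. dist z (z + of_real (t n) * e) \<le> \<delta>"
      using null_steps[OF \<open>\<delta> > 0\<close>] by blast
    have in_K': "z + of_real (t n) * e \<in> K'" if "z \<in> K" for z n
      using \<delta>(2)[OF that t(3)] .
    define d where "d n z = (u (z + of_real (t n) * e) - u z) / of_real (t n)" for n z
    have "continuous_on K (d n)" for n
    proof -
      have "continuous_on K (\<lambda>z. u (z + of_real (t n) * e))"
        by (rule continuous_on_compose2[OF cont[OF K'(1,3)]]) (use in_K' in \<open>auto intro!: continuous_intros\<close>)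
      then show ?thesis
        unfolding d_def using cont[OF K] t(2)[of n] by (intro continuous_intros) auto
    qed
    then have "(\<lambda>z. indicator K z *\<^sub>R d n z) \<in> borel_measurable lebesgue" for n
      using set_borel_measurable_lebesgue_compact[OF K(1)] by (simp add: set_borel_measurable_def)
    moreover have lim: "(\<lambda>n. indicator K z *\<^sub>R d n z) \<longlonglongrightarrow> indicator K z *\<^sub>R g z" if "z \<notin> N" for z
      using quotient[OF _ t(1,2), of z] that K(2) unfolding d_def by (auto simp: indicator_def)
    ultimately show "set_borel_measurable lebesgue K g"
      unfolding set_borel_measurable_def
      by (rule borel_measurable_lebesgue_limit_off_negligible[OF _ N])
    have "cmod (d n z) \<le> L * cmod e" if "z \<in> K" for n z
    proof -
      have "dist (u (z + of_real (t n) * e)) (u z) \<le> L * dist (z + of_real (t n) * e) z"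
        using that K'(2) by (intro lipschitz_onD[OF L in_K']) auto
      also have "\<dots> = L * cmod e * t n"
        using t(2)[of n] by (simp add: dist_norm norm_mult)
      finally show ?thesis
        using t(2)[of n] by (simp add: d_def dist_norm norm_divide divide_le_eq)
    qed
    then have "cmod (g z) \<le> L * cmod e" if "z \<in> K" "z \<notin> N" for z
      using LIMSEQ_le_const2[OF tendsto_norm[OF lim[OF that(2)]]] that(1) by auto
    then show "\<exists>B. AE z in lebesgue. z \<in> K \<longrightarrow> cmod (g z) \<le> B"
      using AE_N by (intro exI[of _ "L * cmod e"]) (auto elim: eventually_mono)
  qed
  have u: "locally_Lp 1 \<Omega> u"
  proof (rule locally_Lp_bounded)
    fix K :: "complex set" assume K: "compact K" "K \<subseteq> \<Omega>"
    show "set_borel_measurable lebesgue K u"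
      by (rule set_borel_measurable_lebesgue_compact[OF K(1) cont[OF K]])
    have "bounded (u ` K)"
      by (rule compact_imp_bounded[OF compact_continuous_image[OF cont[OF K] K(1)]])
    then show "\<exists>B. AE z in lebesgue. z \<in> K \<longrightarrow> cmod (u z) \<le> B"
      by (force simp: bounded_iff)
  qed
  have parts: "(LINT z:\<Omega>|lebesgue. u z * frechet_derivative \<phi> (at z) e) = - (LINT z:\<Omega>|lebesgue. g z * \<phi> z)"
    if \<phi>: "\<phi> \<in> test_functions \<Omega>" for \<phi>
  proof -
    have "C_k (Suc 0) \<phi>"
      using \<phi> unfolding test_functions_def by blast
    then have diff: "\<And>z. \<phi> differentiable (at z)"
      and cont_D: "continuous_on UNIV (\<lambda>z. frechet_derivative \<phi> (at z) e)"
      by auto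
    obtain K where K: "compact K" "K \<subseteq> \<Omega>" and supp: "\<And>z. z \<notin> K \<Longrightarrow> \<phi> z = 0"
      using \<phi> unfolding test_functions_def by blast
    define D where "D z = frechet_derivative \<phi> (at z) e" for z
    have supp_D: "D z = 0" if "z \<notin> K" for z
      unfolding D_def using directional_derivative_vanishes_off_support[of K \<phi> z e] K(1) supp that
      by (simp add: compact_imp_closed)
    have \<phi>_deriv: "((\<lambda>t. \<phi> (z + of_real t * e)) has_vector_derivative D (z + of_real s * e)) (at s)" for z s
      unfolding D_def using diff frechet_derivative_works
      by (intro has_derivative_imp_directional) blast
    have bdd: "\<exists>B\<ge>0. \<forall>z. cmod (f z) \<le> B" if "continuous_on K f" "\<And>z. z \<notin> K \<Longrightarrow> f z = 0" for f :: "complex \<Rightarrow> complex"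
    proof -
      have "bounded (f ` K)"
        by (rule compact_imp_bounded[OF compact_continuous_image[OF that(1) K(1)]])
      then obtain B where "B > 0" "\<forall>z\<in>K. cmod (f z) \<le> B"
        by (auto simp: bounded_pos)
      then show ?thesis
        using that(2) by (intro exI[of _ B]) (metis less_imp_le norm_zero)
    qed
    have cont_\<phi>: "continuous_on K \<phi>"
      using diff by (intro continuous_at_imp_continuous_on) (auto intro: differentiable_imp_continuous_within)
    have cont_D': "continuous_on K D"
      unfolding D_def by (rule continuous_on_subset[OF cont_D]) simp
    obtain B where B: "B \<ge> 0" "\<And>z. cmod (\<phi> z) \<le> B"
      using bdd[OF cont_\<phi> supp] by auto
    obtain C where C: "C \<ge> 0" "\<And>z. cmod (D z) \<le> C"
      using bdd[OF cont_D' supp_D] by auto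
    have \<phi>_lip: "cmod (\<phi> (z + of_real t * e) - \<phi> z) \<le> C * \<bar>t\<bar>" for z t
    proof -
      have "C-lipschitz_on UNIV (\<lambda>t. \<phi> (z + of_real t * e))"
      proof (rule bounded_derivative_imp_lipschitz)
        show "((\<lambda>t. \<phi> (z + of_real t * e)) has_derivative (\<lambda>h. h *\<^sub>R D (z + of_real s * e))) (at s)" for s
          using \<phi>_deriv by (simp add: has_vector_derivative_def)
        show "onorm (\<lambda>h. h *\<^sub>R D (z + of_real s * e)) \<le> C" for s
          using C(2)[of "z + of_real s * e"]
          by (intro onorm_le) (simp add: mult.commute[of C] mult_left_mono)
      qed (use C in auto)
      from lipschitz_onD[OF this, of t 0] show ?thesis
        by (simp add: dist_norm)
    qed
    obtain K' \<delta> where K': "compact K'" "K \<subseteq> K'" "K' \<subseteq> \<Omega>" and \<delta>: "\<delta> > 0"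
      "\<And>x y. x \<in> K \<Longrightarrow> dist x y \<le> \<delta> \<Longrightarrow> y \<in> K'"
      using compact_thickening[OF K(1) \<open>open \<Omega>\<close> K(2)] by blast
    obtain L where L: "L-lipschitz_on K' u"
      using lip K' by blast
    have "bounded (u ` K')"
      by (rule compact_imp_bounded[OF compact_continuous_image[OF cont[OF K'(1,3)] K'(1)]])
    then obtain U where U: "U > 0" "\<And>z. z \<in> K' \<Longrightarrow> cmod (u z) \<le> U"
      by (auto simp: bounded_pos)
    obtain t where t: "t \<longlonglongrightarrow> 0" "\<And>n. t n > 0" "\<And>n z. dist z (z + of_real (t n) * e) \<le> \<delta>"
      using null_steps[OF \<open>\<delta> > 0\<close>] by blast
    define v where "v z = u z * \<phi> z" for z
    define d where "d n z = (v (z + of_real (t n) * e) - v z) / of_real (t n)" for n z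
    define G where "G z = indicator \<Omega> z *\<^sub>R (u z * D z) + indicator \<Omega> z *\<^sub>R (g z * \<phi> z)" for z
    have cont_K_int: "integrable lborel f"
      if "continuous_on K f" "\<And>z. z \<notin> K \<Longrightarrow> f z = 0" for f :: "complex \<Rightarrow> complex"
    proof -
      have "(\<lambda>z. indicator K z *\<^sub>R f z) = f"
        using that(2) by (auto simp: indicator_def)
      then show ?thesis
        using borel_integrable_compact[OF K(1) that(1)] by simp
    qed
    have "integrable lborel v"
      unfolding v_def using cont[OF K] cont_\<phi> supp by (intro cont_K_int continuous_intros) auto
    from integral_difference_quotient_eq_0[OF this]
    have d_int: "integrable lborel (d n)" "integral\<^sup>L lborel (d n) = 0" for n
      unfolding d_def by blast+
    have d_meas: "d n \<in> borel_measurable lborel" for n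
      using d_int(1) by (rule borel_measurable_integrable)
    \<comment> \<open>The steps are too short to lead from outside the thickening \<open>K'\<close> into the support \<open>K\<close>.\<close>
    have d_zero: "d n z = 0" if "z \<notin> K'" for n z
    proof -
      have "z + of_real (t n) * e \<notin> K"
        using \<delta>(2)[of "z + of_real (t n) * e" z] t(3)[of z n] that by (auto simp: dist_commute)
      moreover have "z \<notin> K"
        using that K'(2) by blast
      ultimately show ?thesis
        by (simp add: d_def v_def supp)
    qed
    \<comment> \<open>If one of the two points lies in \<open>K\<close>, then both lie in \<open>K'\<close>, where the estimates for \<open>u\<close> apply;
      otherwise the quotient is 0.\<close>
    have d_bound: "cmod (d n z) \<le> indicator K' z *\<^sub>R (U * C + B * (L * cmod e))" for n z
    proof (cases "z \<in> K'")
      case z: True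
      let ?z = "z + of_real (t n) * e"
      show ?thesis
      proof (cases "z \<in> K \<or> ?z \<in> K")
        case True
        then have z': "?z \<in> K'"
          using \<delta>(2)[OF _ t(3)] K'(2) by blast
        have "v ?z - v z = u ?z * (\<phi> ?z - \<phi> z) + \<phi> z * (u ?z - u z)"
          by (simp add: v_def algebra_simps)
        then have "cmod (v ?z - v z) \<le> cmod (u ?z) * cmod (\<phi> ?z - \<phi> z) + cmod (\<phi> z) * cmod (u ?z - u z)"
          by (metis norm_mult norm_triangle_ineq)
        also have "\<dots> \<le> U * (C * t n) + B * (L * (t n * cmod e))"
        proof (intro add_mono mult_mono)
          show "cmod (\<phi> ?z - \<phi> z) \<le> C * t n"
            using \<phi>_lip[of z "t n"] t(2)[of n] by simp
          show "cmod (u ?z - u z) \<le> L * (t n * cmod e)"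
            using lipschitz_onD[OF L z' z] t(2)[of n] by (simp add: dist_norm norm_mult)
        qed (use U B z' in auto)
        also have "\<dots> = (U * C + B * (L * cmod e)) * t n"
          by (simp add: algebra_simps)
        finally show ?thesis
          using t(2)[of n] z by (simp add: d_def norm_divide divide_le_eq)
      next
        case False
        then show ?thesis
          using z U(1) C(1) B(1) lipschitz_on_nonneg[OF L] by (simp add: d_def v_def supp)
      qed
    qed (simp add: d_zero)
    have d_lim: "(\<lambda>n. d n z) \<longlonglongrightarrow> G z" if "z \<notin> N" for z
    proof (cases "z \<in> \<Omega>")
      case True
      have "((\<lambda>s. v (z + of_real s * e)) has_vector_derivative (u z * D z + g z * \<phi> z)) (at 0)"
        unfolding v_def
        using has_vector_derivative_mult[OF deriv[of z] \<phi>_deriv[of z 0]] True that by simp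
      from has_vector_derivative_imp_quotient_LIMSEQ[OF this t(1,2)] show ?thesis
        using True by (simp add: d_def G_def)
    next
      case False
      then have "z \<notin> K'"
        using K'(3) by blast
      then show ?thesis
        using False d_zero by (simp add: G_def)
    qed
    have "integrable lborel (\<lambda>z. indicator K' z *\<^sub>R (U * C + B * (L * cmod e)))"
      using K'(1) by (intro borel_integrable_compact) auto
    then have w: "integrable lebesgue (\<lambda>z. indicator K' z *\<^sub>R (U * C + B * (L * cmod e)))"
      by (rule integrable_lborel_imp_lebesgue)
    have d_meas': "d n \<in> borel_measurable lebesgue" for n
      using d_meas by (rule measurable_completion)
    have G_meas: "G \<in> borel_measurable lebesgue"
      using borel_measurable_lebesgue_limit_off_negligible[OF d_meas' N d_lim] .
    have AE_lim: "AE z in lebesgue. (\<lambda>n. d n z) \<longlonglongrightarrow> G z"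
      using AE_N by eventually_elim (rule d_lim)
    have AE_bound: "AE z in lebesgue. norm (d n z) \<le> indicator K' z *\<^sub>R (U * C + B * (L * cmod e))" for n
      using d_bound by simp
    have G_int: "integrable lebesgue G"
      by (rule integrable_dominated_convergence[OF G_meas d_meas' w AE_lim AE_bound])
    have "(\<lambda>n. integral\<^sup>L lebesgue (d n)) \<longlonglongrightarrow> integral\<^sup>L lebesgue G"
      by (rule integral_dominated_convergence[OF G_meas d_meas' w AE_lim AE_bound])
    then have "(\<lambda>n::nat. 0) \<longlonglongrightarrow> integral\<^sup>L lebesgue G"
      using d_int(2) d_meas by (simp add: integral_completion)
    then have G0: "integral\<^sup>L lebesgue G = 0"
      using LIMSEQ_unique tendsto_const by blast
    have "integrable lborel (\<lambda>z. u z * D z)"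
      using cont[OF K] cont_D' supp_D by (intro cont_K_int continuous_intros) auto
    then have "integrable lebesgue (\<lambda>z. u z * D z)"
      by (rule integrable_lborel_imp_lebesgue)
    moreover have "(\<lambda>z. indicator \<Omega> z *\<^sub>R (u z * D z)) = (\<lambda>z. u z * D z)"
      using supp_D K(2) by (intro ext) (metis indicator_simps mult_zero_right scaleR_one scaleR_zero_right subsetD)
    ultimately have 1: "integrable lebesgue (\<lambda>z. indicator \<Omega> z *\<^sub>R (u z * D z))"
      by simp
    have "integrable lebesgue (\<lambda>z. G z - indicator \<Omega> z *\<^sub>R (u z * D z))"
      using G_int 1 by (rule Bochner_Integration.integrable_diff)
    then have 2: "integrable lebesgue (\<lambda>z. indicator \<Omega> z *\<^sub>R (g z * \<phi> z))"
      by (simp add: G_def)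
    have "(LINT z|lebesgue. indicator \<Omega> z *\<^sub>R (u z * D z)) + (LINT z|lebesgue. indicator \<Omega> z *\<^sub>R (g z * \<phi> z)) = 0"
      using G0 unfolding G_def Bochner_Integration.integral_add[OF 1 2] .
    then show ?thesis
      unfolding set_lebesgue_integral_def D_def by (simp add: eq_neg_iff_add_eq_0)
  qed
  show "has_distr_deriv \<Omega> e u g"
    unfolding has_distr_deriv_def using u g parts by blast
qed

section \<open>Quasiconformality of the extension\<close>

text \<open>With real derivative \<open>h \<mapsto> P * h + Q * cnj h\<close>, the function \<open>P\<close> is the derivative with respect to
  \<open>z\<close> and \<open>Q\<close> the one with respect to \<open>cnj z\<close>. So only a pointwise bound remains to be checked once
  the distributional derivatives are known to be the pointwise ones.\<close>

lemma quasiconformalI_locally_lipschitz: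
  fixes F :: "complex option \<Rightarrow> complex option" and P Q :: "complex \<Rightarrow> complex"
  defines "u \<equiv> finite_part (\<lambda>z. F (Some z))"
  assumes homeo: "homeomorphic_map sphere_top sphere_top F"
    and \<Omega>: "{z. F (Some z) \<noteq> None} = \<Omega>" "open \<Omega>" and N: "negligible N"
    and lip: "\<And>K. compact K \<Longrightarrow> K \<subseteq> \<Omega> \<Longrightarrow> \<exists>L. L-lipschitz_on K u"
    and deriv: "\<And>z. z \<in> \<Omega> - N \<Longrightarrow> (u has_derivative (\<lambda>h. P z * h + Q z * cnj h)) (at z)"
    and dil: "\<And>z. z \<in> \<Omega> - N \<Longrightarrow> cmod (Q z) \<le> k * cmod (P z)"
  shows "quasiconformal k F"
proof -
  define g where "g e z = P z * e + Q z * cnj e" for e z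
  have dir: "((\<lambda>t. u (z + of_real t * e)) has_vector_derivative g e z) (at 0)" if "z \<in> \<Omega> - N" for e z
    using has_derivative_imp_directional[of u "\<lambda>h. P z * h + Q z * cnj h" z 0 e] deriv[OF that]
    by (simp add: g_def)
  note loc = locally_lipschitz_imp_locally_Lp_deriv[OF \<Omega>(2) N lip dir]
    and distr = locally_lipschitz_imp_has_distr_deriv[OF \<Omega>(2) N lip dir]
  have z: "(g 1 z + \<i> * g \<i> z) / 2 = Q z" "(g 1 z - \<i> * g \<i> z) / 2 = P z" for z
    by (simp_all add: g_def algebra_simps)
  have "AE z in lebesgue. z \<notin> N"
    using N by (simp add: negligible_iff_null_sets AE_not_in)
  then have "AE z in lebesgue. z \<in> \<Omega> \<longrightarrow>
      cmod ((g 1 z + \<i> * g \<i> z) / 2) \<le> k * cmod ((g 1 z - \<i> * g \<i> z) / 2)"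
    by eventually_elim (use dil in \<open>simp add: z\<close>)
  then show ?thesis
    unfolding quasiconformal_def Let_def u_def[symmetric] \<Omega>(1)
    using homeo loc distr by blast
qed

lemma quasiconformal_sphere_ext:
  assumes w: "(k / (1 + p)\<^sup>2)-lipschitz_on (cball 0 1) w" and p: "0 \<le> p" "p < 1" and "k < 1"
    and hol: "w holomorphic_on ball 0 1"
    and bound: "\<And>z. z \<in> ball 0 1 \<Longrightarrow> cmod (deriv w z) \<le> k / (1 + p)\<^sup>2"
  shows "quasiconformal k (sphere_ext p w)"
proof -
  define c where "c = complex_of_real p"
  define u where "u = finite_part (\<lambda>z. sphere_ext p w (Some z))"
  define P where "P z = - 1 / (z - c)\<^sup>2 + (if cmod z < 1 then deriv w z else 0)" for z
  define Q where "Q z = (if cmod z < 1 then 0 else - deriv w (1 / cnj z) / (cnj z)\<^sup>2)" for z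
  have k: "0 \<le> k"
    using lipschitz_on_nonneg[OF w] p by (simp add: zero_le_divide_iff)
  have u: "u z = 1 / (z - c) + reflect_ext w z" if "z \<noteq> c" for z
    using that by (simp add: u_def finite_part_def sphere_ext_Some c_def)
  show ?thesis
  proof (rule quasiconformalI_locally_lipschitz[where F = "sphere_ext p w" and \<Omega> = "- {c}" and N = "sphere 0 1" and P = P and Q = Q,
        folded u_def])
    show "homeomorphic_map sphere_top sphere_top (sphere_ext p w)"
      by (rule homeomorphic_map_sphere_ext[OF w p \<open>k < 1\<close>])
    show "{z. sphere_ext p w (Some z) \<noteq> None} = - {c}"
      by (auto simp: sphere_ext_Some c_def)
    show "negligible (sphere 0 1 :: complex set)"
      by (rule negligible_sphere)
    \<comment> \<open>A compact set that avoids the pole keeps a distance \<open>d\<close> from it.\<close>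
    show "\<exists>L. L-lipschitz_on K u" if K: "compact K" "K \<subseteq> - {c}" for K
    proof -
      obtain d where d: "d > 0" "\<And>z. z \<in> K \<Longrightarrow> d \<le> cmod (z - c)"
        using separate_point_closed[of K c] K by (auto simp: compact_imp_closed dist_norm norm_minus_commute)
      have nz: "z \<noteq> c" if "z \<in> K" for z
        using K(2) that by blast
      have "(1 / d\<^sup>2)-lipschitz_on K (\<lambda>z. 1 / (z - c))"
      proof (rule lipschitz_onI)
        fix x y assume xy: "x \<in> K" "y \<in> K"
        have "1 / (x - c) - 1 / (y - c) = (y - x) / ((x - c) * (y - c))"
          using nz xy by (simp add: field_simps)
        then have "dist (1 / (x - c)) (1 / (y - c)) = dist x y / (cmod (x - c) * cmod (y - c))"
          by (simp add: dist_norm norm_divide norm_mult norm_minus_commute)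
        also have "\<dots> \<le> dist x y / d\<^sup>2"
          using d xy unfolding power2_eq_square
          by (intro divide_left_mono mult_mono mult_pos_pos) (auto simp: nz)
        finally show "dist (1 / (x - c)) (1 / (y - c)) \<le> 1 / d\<^sup>2 * dist x y"
          by simp
      qed simp
      then have "(1 / d\<^sup>2 + k / (1 + p)\<^sup>2)-lipschitz_on K (\<lambda>z. 1 / (z - c) + reflect_ext w z)"
        using lipschitz_on_subset[OF lipschitz_reflect_ext[OF w]] by (intro lipschitz_on_add) auto
      then have "(1 / d\<^sup>2 + k / (1 + p)\<^sup>2)-lipschitz_on K u"
        by (rule lipschitz_on_transform) (use u nz in auto)
      then show ?thesis ..
    qed
  next
    fix z assume "z \<in> - {c} - sphere 0 1"
    then have z: "z \<noteq> c" "cmod z \<noteq> 1"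
      by auto
    have "((\<lambda>z. 1 / (z - c)) has_field_derivative - 1 / (z - c)\<^sup>2) (at z)"
      using z(1) by (auto intro!: derivative_eq_intros simp: power2_eq_square)
    then have pole: "((\<lambda>z. 1 / (z - c)) has_derivative (\<lambda>h. - 1 / (z - c)\<^sup>2 * h)) (at z)"
      unfolding has_field_derivative_def .
    have refl: "(reflect_ext w has_derivative
        (\<lambda>h. (if cmod z < 1 then deriv w z else 0) * h + Q z * cnj h)) (at z)"
      using reflect_ext_has_derivative_inside[OF hol, of z]
        reflect_ext_has_derivative_outside[OF hol, of z] z(2)
      by (cases "cmod z < 1") (auto simp: Q_def)
    have "((\<lambda>z. 1 / (z - c) + reflect_ext w z) has_derivative (\<lambda>h. P z * h + Q z * cnj h)) (at z)"
      unfolding P_def distrib_right add.assoc by (rule has_derivative_add[OF pole refl])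
    then show "(u has_derivative (\<lambda>h. P z * h + Q z * cnj h)) (at z)"
      by (rule has_derivative_transform_within_open[of _ _ _ _ "- {c}"]) (use z u in auto)
    \<comment> \<open>In the disc the map is holomorphic. Outside, the inequality reduces to
      \<open>cmod (z - c) \<le> (1 + p) * cmod z\<close>.\<close>
    show "cmod (Q z) \<le> k * cmod (P z)"
    proof (cases "cmod z < 1")
      case False
      then have z1: "cmod z > 1"
        using z(2) by simp
      have "cmod (z - c) \<le> cmod z + p"
        using norm_triangle_ineq4[of z c] p by (simp add: c_def)
      also have "\<dots> \<le> (1 + p) * cmod z"
        using mult_left_mono[of 1 "cmod z" p] z1 p by (simp add: algebra_simps)
      finally have "cmod (z - c) ^ 2 \<le> ((1 + p) * cmod z) ^ 2"
        by (rule power_mono) simp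
      then have le: "k / ((1 + p) * cmod z) ^ 2 \<le> k / cmod (z - c) ^ 2"
        using k z(1) z1 p by (intro divide_left_mono mult_pos_pos) auto
      have "cmod (deriv w (1 / cnj z)) / cmod z ^ 2 \<le> k / (1 + p)\<^sup>2 / cmod z ^ 2"
        by (intro divide_right_mono bound reflection_in_ball z1) simp
      also have "\<dots> = k / ((1 + p) * cmod z) ^ 2"
        by (simp add: power_mult_distrib)
      finally show ?thesis
        using le False by (simp add: P_def Q_def norm_divide norm_power)
    qed (use k in \<open>simp add: Q_def\<close>)
  qed (auto simp: open_Compl)
qed

section \<open>The univalent function and its extension\<close>

text \<open>The disc is convex, so the derivative bound is a Lipschitz bound, and this provides the boundary
  values on the unit circle.\<close>

lemma holomorphic_lipschitz_extension:
  assumes hol: "\<omega> holomorphic_on ball 0 1"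
    and bound: "\<And>z. z \<in> ball 0 1 \<Longrightarrow> cmod (deriv \<omega> z) \<le> M" and "0 \<le> M"
  obtains w where "M-lipschitz_on (cball 0 1) w" "\<And>z. z \<in> ball 0 1 \<Longrightarrow> w z = \<omega> z"
proof -
  have "M-lipschitz_on (ball 0 1) \<omega>"
  proof (rule bounded_derivative_imp_lipschitz)
    show "(\<omega> has_derivative (\<lambda>h. deriv \<omega> z * h)) (at z within ball 0 1)" if "z \<in> ball 0 1" for z
      using holomorphic_derivI[OF hol open_ball that]
      by (metis has_field_derivative_def has_field_derivative_at_within)
    show "onorm (\<lambda>h. deriv \<omega> z * h) \<le> M" if "z \<in> ball 0 1" for z
      using bound[OF that] by (intro onorm_le) (simp add: norm_mult mult_right_mono)
  qed (use \<open>0 \<le> M\<close> in auto)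
  from lipschitz_extend_closure[OF this] show ?thesis
    using that by (auto simp: closure_ball)
qed

text \<open>Near the pole the function is \<open>h z / (z - p)\<close> with \<open>h z = 1 + (z - p) * \<omega> z\<close> holomorphic and
  \<open>h p = 1\<close>, which settles type, order and residue of the singularity at once.\<close>

lemma Sigma_classI:
  assumes \<omega>: "\<omega> holomorphic_on ball 0 1" and p: "0 \<le> p" "p < 1"
    and f: "\<And>z. z \<in> ball 0 1 \<Longrightarrow>
           f z = (if z = of_real p then None else Some (1 / (z - of_real p) + \<omega> z))"
    and inj: "inj_on f (ball 0 1)"
  shows "f \<in> Sigma_class p"
proof -
  define c where "c = complex_of_real p"
  define g where "g = finite_part f"
  define h where "h z = 1 + (z - c) * \<omega> z" for z
  have c: "c \<in> ball 0 1"
    using p by (simp add: c_def)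
  have h: "h holomorphic_on ball 0 1" "h c = 1"
    unfolding h_def using \<omega> by (auto intro!: holomorphic_intros)
  have g: "g z = (if z = c then 0 else h z / (z - c))" if "z \<in> ball 0 1" for z
    using f[OF that] by (auto simp: g_def finite_part_def c_def h_def field_simps)
  have ev: "\<forall>\<^sub>F z in at c. g z = h z / (z - c)"
    using eventually_at_in_open[OF open_ball c] by eventually_elim (simp add: g)
  have "(\<lambda>z. h z / (z - c)) holomorphic_on ball 0 1 - {c}"
    using h(1) by (auto intro!: holomorphic_intros elim: holomorphic_on_subset)
  then have hol: "g holomorphic_on ball 0 1 - {c}"
    by (rule holomorphic_transform) (simp add: g)
  have pole: "is_pole g c"
    using is_pole_basic[OF h(1) open_ball c, of 1] h(2) by (simp add: is_pole_cong[OF ev])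
  have no_pole: "\<not> is_pole g z" if "z \<in> ball 0 1 - {c}" for z
    by (rule not_is_pole_holomorphic[OF _ that hol]) auto
  have "g nicely_meromorphic_on ball 0 1"
  proof (rule nicely_meromorphic_onI_open[where pts = "{c}"])
    show "g analytic_on ball 0 1 - {c}"
      using hol by (subst analytic_on_open) auto
    show "is_pole g x \<and> g x = 0" if "x \<in> {c}" for x
      using that pole c by (simp add: g)
    show "isolated_singularity_at g x" if "x \<in> ball 0 1" for x
    proof (cases "x = c")
      case True
      then show ?thesis
        using hol that by (intro isolated_singularity_at_holomorphic[of _ "ball 0 1"]) auto
    next
      case False
      then show ?thesis
        using hol that
        by (intro isolated_singularity_at_holomorphic[of _ "ball 0 1 - {c}"]) (auto elim: holomorphic_on_subset)
    qed
  qed auto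
  then have "sphere_meromorphic_on f (ball 0 1)"
    unfolding sphere_meromorphic_on_def g_def[symmetric]
    using pole no_pole f by (auto simp: c_def)
  moreover have "zorder g c = -1"
    by (rule zorder_eqI[OF open_ball c h(1)]) (auto simp: h(2) g power_int_minus divide_inverse)
  moreover have "residue g c = 1"
    using residue_simple[OF open_ball c h(1)] h(2) by (simp add: residue_cong[OF ev refl])
  ultimately show ?thesis
    unfolding Sigma_class_def using inj pole by (simp add: g_def c_def)
qed

theorem theorem2:
  fixes k p :: real and \<omega> :: "complex \<Rightarrow> complex" and f :: "complex \<Rightarrow> complex option"
  assumes "0 \<le> k" "k < 1" and "0 \<le> p" "p < 1"
    and "\<omega> analytic_on ball 0 1"
    and "\<And>z. z \<in> ball 0 1 \<Longrightarrow> cmod (deriv \<omega> z) \<le> k / (1 + p)\<^sup>2"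
    and "\<And>z. z \<in> ball 0 1 \<Longrightarrow>
           f z = (if z = of_real p then None else Some (1 / (z - of_real p) + \<omega> z))"
  shows "f \<in> Sigma_k_class k p \<and>
    (\<exists>F. qc_extension k f F \<and>
       (\<forall>z. cmod z > 1 \<longrightarrow> F (Some z) = Some (1 / (z - of_real p) + \<omega> (1 / cnj z))))"
proof -
  have \<omega>: "\<omega> holomorphic_on ball 0 1"
    using assms(5) by (simp add: analytic_on_open)
  obtain w where w: "(k / (1 + p)\<^sup>2)-lipschitz_on (cball 0 1) w"
    and w_eq: "\<And>z. z \<in> ball 0 1 \<Longrightarrow> w z = \<omega> z"
    using holomorphic_lipschitz_extension[OF \<omega> assms(6)] assms(1) by auto
  have hol: "w holomorphic_on ball 0 1"
    using \<omega> by (rule holomorphic_transform) (simp add: w_eq)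
  have "deriv w z = deriv \<omega> z" if "z \<in> ball 0 1" for z
    using eventually_nhds_in_open[OF open_ball that]
    by (intro deriv_cong_ev) (auto elim!: eventually_mono simp: w_eq)
  then have bound: "cmod (deriv w z) \<le> k / (1 + p)\<^sup>2" if "z \<in> ball 0 1" for z
    using assms(6)[OF that] that by simp
  have F_f: "sphere_ext p w (Some z) = f z" if "z \<in> ball 0 1" for z
    using assms(7)[OF that] w_eq[OF that] that by (simp add: sphere_ext_Some reflect_ext_def)
  have ext: "qc_extension k f (sphere_ext p w)"
    unfolding qc_extension_def
    using quasiconformal_sphere_ext[OF w assms(3,4,2) hol bound] F_f by blast
  have "inj_on (\<lambda>z. sphere_ext p w (Some z)) (ball 0 1)"
    using homeomorphic_imp_injective_map[OF homeomorphic_map_sphere_ext[OF w assms(3,4,2)]]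
    by (auto simp: inj_on_def)
  then have "inj_on f (ball 0 1)"
    by (rule inj_on_cong[THEN iffD1, rotated]) (rule F_f)
  then have "f \<in> Sigma_k_class k p"
    unfolding Sigma_k_class_def using Sigma_classI[OF \<omega> assms(3,4,7)] ext by blast
  moreover have "sphere_ext p w (Some z) = Some (1 / (z - of_real p) + \<omega> (1 / cnj z))" if "cmod z > 1" for z
  proof -
    have "z \<noteq> of_real p"
      using that assms(3,4) by auto
    moreover have "1 / cnj z \<in> ball 0 1"
      by (rule reflection_in_ball[OF that])
    ultimately show ?thesis
      using that w_eq by (simp add: sphere_ext_Some reflect_ext_def)
  qed
  ultimately show ?thesis
    using ext by blast
qed

end
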